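(* For every nonnegative integer $n$, $$\sum_{a+b=n}2^{b+1}\zeta(a+1,\overline{b+1})=(n+1)\zeta(n+2)+2\zeta(n+1,\overline{1})+2\zeta(\overline{n+2}),$$ where the sum runs over nonnegative integers $a,b$.
   Context: $\zeta$ is the Riemann zeta function. For positive integers $s$, $\zeta(\overline{s})=\sum_{k\ge1}(-1)^k k^{-s}$, and for positive integers $s_1,s_2$, $\zeta(s_1,\overline{s_2})=\sum_{1\le k_1<k_2}\frac{(-1)^{k_2}}{k_1^{s_1}k_2^{s_2}}$ (a bar over an argument means a factor $(-1)^{k_j}$ attached to the corresponding summation index; the series converge, conditionally when the barred argument is $1$). *)

theory Defs
  imports "HOL-Analysis.Analysis" "HOL-Real_Asymp.Real_Asymp"
begin

text \<open>
  All series are over \<open>k \<ge> 1\<close>, encoded as \<open>Suc k\<close> with \<open>k :: nat\<close>. All arguments are positive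
  integers; the convergence lemmas below give the range in which the sums are meaningful.
\<close>

definition zeta :: "nat \<Rightarrow> real" where
  "zeta s = (\<Sum>k. 1 / real (Suc k) ^ s)"

definition zeta_bar :: "nat \<Rightarrow> real" where
  "zeta_bar s = (\<Sum>k. (-1) ^ Suc k / real (Suc k) ^ s)"

text \<open>
  \<open>zeta2_bar s\<^sub>1 s\<^sub>2\<close> is $\zeta(s_1,\overline{s_2})$. The double series need not converge absolutely;
  its value is the limit of the partial sums over \<open>1 \<le> k\<^sub>1 < k\<^sub>2 \<le> N\<close> as \<open>N\<close> tends to infinity
  (see \<open>zeta2_bar_LIMSEQ\<close>).
\<close>

definition zeta2_bar :: "nat \<Rightarrow> nat \<Rightarrow> real" where
  "zeta2_bar s\<^sub>1 s\<^sub>2 =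
     (\<Sum>k. \<Sum>k\<^sub>1 = 1..<Suc k. (-1) ^ Suc k / (real k\<^sub>1 ^ s\<^sub>1 * real (Suc k) ^ s\<^sub>2))"

lemma summable_zeta: "s \<ge> 2 \<Longrightarrow> summable (\<lambda>k. 1 / real (Suc k) ^ s)"
  using inverse_power_summable[of s, where ?'a = real]
  by (subst summable_Suc_iff) (simp add: inverse_eq_divide)

lemma summable_zeta_bar:
  assumes "s \<ge> 1"
  shows "summable (\<lambda>k. (-1) ^ Suc k / real (Suc k) ^ s)"
proof -
  have "(\<lambda>k. 1 / real (Suc k) ^ s) \<longlonglongrightarrow> 0"
  proof (rule tendsto_sandwich[OF _ _ tendsto_const])
    show "(\<lambda>k. 1 / real (Suc k)) \<longlonglongrightarrow> 0" by real_asymp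
    have "real (Suc k) ^ 1 \<le> real (Suc k) ^ s" for k
      using assms by (intro power_increasing) auto
    then show "\<forall>\<^sub>F k in sequentially. 1 / real (Suc k) ^ s \<le> 1 / real (Suc k)"
      by (intro always_eventually allI divide_left_mono) auto
  qed auto
  moreover have "monoseq (\<lambda>k. 1 / real (Suc k) ^ s)"
    by (intro decseq_imp_monoseq decseq_SucI divide_left_mono power_mono) auto
  ultimately have "summable (\<lambda>k. (-1) ^ k * (1 / real (Suc k) ^ s))"
    by (rule summable_Leibniz(1))
  from summable_minus[OF this] show ?thesis by simp
qed

lemma summable_zeta2_bar:
  assumes "s\<^sub>1 \<ge> 1" "s\<^sub>2 \<ge> 1"
  shows "summable (\<lambda>k. \<Sum>k\<^sub>1 = 1..<Suc k. (-1) ^ Suc k / (real k\<^sub>1 ^ s\<^sub>1 * real (Suc k) ^ s\<^sub>2))"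
proof -
  define S where "S k = (\<Sum>j = 1..<Suc k. 1 / real j ^ s\<^sub>1)" for k
  define f where "f k = S (Suc k) / real (k + 2) ^ s\<^sub>2" for k
  have pow: "x \<le> x ^ s" if "x \<ge> 1" "s \<ge> 1" for x :: real and s
    using power_increasing[of 1 s x] that by simp
  have S_Suc: "S (Suc k) = S k + 1 / real (Suc k) ^ s\<^sub>1" for k
    by (simp add: S_def)
  have S_ge: "S (Suc k) \<ge> 1" for k
  proof (induction k)
    case (Suc k)
    then show ?case by (subst S_Suc) (simp add: add_increasing2)
  qed (simp add: S_def)
  have S_le: "S k \<le> harm k" for k
    unfolding S_def harm_def atLeastLessThanSuc_atLeastAtMost inverse_eq_divide
    using assms by (intro sum_mono divide_left_mono) (auto intro!: self_le_power)
  have "f \<longlonglongrightarrow> 0"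
  proof (rule tendsto_sandwich[OF _ _ tendsto_const])
    show "(\<lambda>k. (1 + ln (real (Suc k))) / real (k + 2)) \<longlonglongrightarrow> 0" by real_asymp
    show "\<forall>\<^sub>F k in sequentially. 0 \<le> f k"
      by (intro always_eventually allI) (simp add: f_def order.trans[OF zero_le_one S_ge])
    show "\<forall>\<^sub>F k in sequentially. f k \<le> (1 + ln (real (Suc k))) / real (k + 2)"
    proof (intro always_eventually allI)
      fix k
      have "harm (Suc k) - ln (real (Suc k)) \<le> harm 1 - ln (real 1)"
        using euler_mascheroni_sequence_decreasing[of 1 "Suc k"] by simp
      then have "S (Suc k) \<le> 1 + ln (real (Suc k))"
        using S_le[of "Suc k"] by (simp add: harm_def)
      then show "f k \<le> (1 + ln (real (Suc k))) / real (k + 2)"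
        unfolding f_def using assms S_ge[of k]
        by (intro frac_le) (auto intro!: pow)
    qed
  qed
  moreover have "decseq f"
  proof (rule decseq_SucI)
    fix k
    define x where "x = real (k + 2)"
    have x: "x \<ge> 2" by (simp add: x_def)
    obtain t where t: "s\<^sub>2 = Suc t" using assms by (cases s\<^sub>2) auto
    have "1 / x ^ s\<^sub>1 \<le> 1 / x"
      using assms x by (intro divide_left_mono pow) auto
    also have "\<dots> \<le> S (Suc k) / x"
      using S_ge x by (intro divide_right_mono) auto
    finally have "1 / x ^ s\<^sub>1 \<le> S (Suc k) / x" .
    moreover have "S (Suc (Suc k)) = S (Suc k) + 1 / x ^ s\<^sub>1"
      using S_Suc[of "Suc k"] by (simp add: x_def add_ac)
    moreover have "S (Suc k) * ((x + 1) / x) = S (Suc k) + S (Suc k) / x"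
      using x by (simp add: field_simps)
    ultimately have "S (Suc (Suc k)) \<le> S (Suc k) * ((x + 1) / x)"
      by linarith
    moreover have "x ^ t \<le> (x + 1) ^ t" using x by (intro power_mono) auto
    ultimately have "S (Suc (Suc k)) * x ^ t \<le> S (Suc k) * ((x + 1) / x) * (x + 1) ^ t"
      using x S_ge[of k] by (intro mult_mono) auto
    then have "S (Suc (Suc k)) * x ^ s\<^sub>2 \<le> S (Suc k) * (x + 1) ^ s\<^sub>2"
      using x by (simp add: t field_simps)
    moreover have "x ^ s\<^sub>2 > 0" "(x + 1) ^ s\<^sub>2 > 0" using x by auto
    ultimately have "S (Suc (Suc k)) / (x + 1) ^ s\<^sub>2 \<le> S (Suc k) / x ^ s\<^sub>2"
      by (simp only: pos_divide_le_eq pos_le_divide_eq times_divide_eq_left)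
    then show "f (Suc k) \<le> f k" by (simp add: f_def x_def add_ac)
  qed
  ultimately have "summable (\<lambda>k. (-1) ^ k * f k)"
    by (intro summable_Leibniz(1) decseq_imp_monoseq)
  also have "(\<lambda>k. (-1) ^ k * f k) = (\<lambda>k. \<Sum>k\<^sub>1 = 1..<Suc (Suc k).
      (-1) ^ Suc (Suc k) / (real k\<^sub>1 ^ s\<^sub>1 * real (Suc (Suc k)) ^ s\<^sub>2))"
    by (rule ext) (simp add: f_def S_def sum_divide_distrib sum_distrib_left add_ac
          del: sum.op_ivl_Suc)
  finally show ?thesis by (subst (asm) summable_Suc_iff)
qed

lemma zeta2_bar_LIMSEQ:
  assumes "s\<^sub>1 \<ge> 1" "s\<^sub>2 \<ge> 1"
  shows "(\<lambda>N. \<Sum>(k\<^sub>1, k\<^sub>2) \<in> {(k\<^sub>1, k\<^sub>2). 1 \<le> k\<^sub>1 \<and> k\<^sub>1 < k\<^sub>2 \<and> k\<^sub>2 \<le> N}.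
            (-1) ^ k\<^sub>2 / (real k\<^sub>1 ^ s\<^sub>1 * real k\<^sub>2 ^ s\<^sub>2)) \<longlonglongrightarrow> zeta2_bar s\<^sub>1 s\<^sub>2"
proof -
  let ?g = "\<lambda>k\<^sub>1 k\<^sub>2. (-1) ^ k\<^sub>2 / (real k\<^sub>1 ^ s\<^sub>1 * real k\<^sub>2 ^ s\<^sub>2)"
  have "(\<Sum>k<N. \<Sum>k\<^sub>1 = 1..<Suc k. ?g k\<^sub>1 (Suc k)) =
        (\<Sum>(k\<^sub>1, k\<^sub>2) \<in> {(k\<^sub>1, k\<^sub>2). 1 \<le> k\<^sub>1 \<and> k\<^sub>1 < k\<^sub>2 \<and> k\<^sub>2 \<le> N}. ?g k\<^sub>1 k\<^sub>2)" for N
  proof -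
    have "(\<Sum>k<N. \<Sum>k\<^sub>1 = 1..<Suc k. ?g k\<^sub>1 (Suc k)) =
          (\<Sum>(k, k\<^sub>1) \<in> (SIGMA k:{..<N}. {1..<Suc k}). ?g k\<^sub>1 (Suc k))"
      by (rule sum.Sigma) auto
    also have "\<dots> = (\<Sum>(k\<^sub>1, k\<^sub>2) \<in> {(k\<^sub>1, k\<^sub>2). 1 \<le> k\<^sub>1 \<and> k\<^sub>1 < k\<^sub>2 \<and> k\<^sub>2 \<le> N}. ?g k\<^sub>1 k\<^sub>2)"
      by (rule sum.reindex_bij_witness[where
            i = "\<lambda>(k\<^sub>1, k\<^sub>2). (k\<^sub>2 - 1, k\<^sub>1)" and j = "\<lambda>(k, k\<^sub>1). (k\<^sub>1, Suc k)"]) auto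
    finally show ?thesis .
  qed
  with summable_LIMSEQ[OF summable_zeta2_bar[OF assms]] show ?thesis
    by (simp only: zeta2_bar_def)
qed

end

theory Submission
  imports Defs
begin

text \<open>
  Truncate all series at \<open>k\<^sub>2 \<le> K\<close>. For \<open>k \<noteq> 2j\<close> the geometric sum
  \<open>\<Sum>\<^bsub>a+b=n\<^esub> 2\<^bsup>b+1\<^esup> / (j\<^bsup>a+1\<^esup> k\<^bsup>b+1\<^esup>)\<close> equals \<open>2 (j\<^bsup>-n-1\<^esup> - (2/k)\<^bsup>n+1\<^esup>) / (k - 2j)\<close>, and the
  diagonal \<open>k = 2j\<close> contributes exactly \<open>(n+1) \<zeta>(n+2)\<close>. The terms with \<open>(2/k)\<^bsup>n+1\<^esup>\<close> cancel under
  \<open>j \<mapsto> k - j\<close>. In the remaining terms, summing \<open>(-1)\<^bsup>k\<^esup> / (k - 2j)\<close> over \<open>j < k \<le> K\<close> leaves, after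
  cancellation of opposite denominators, the alternating harmonic sum from \<open>j\<close> to \<open>K - 2j\<close>.
  Replacing its upper end by \<open>K\<close> costs \<open>O(log K / K)\<close> in total and yields twice the sum of
  \<open>(-1)\<^bsup>k\<^esup> / (j\<^bsup>n+1\<^esup> k)\<close> over \<open>j \<le> k \<le> K\<close>, whose terms \<open>j < k\<close> and \<open>j = k\<close> give the two barred values.
\<close>

section \<open>Alternating harmonic sums and a reflected sum\<close>

definition alt_harm :: "nat \<Rightarrow> real" where
  "alt_harm n = (\<Sum>m = 1..n. (-1) ^ m / real m)"

lemma alt_harm_Suc: "alt_harm (Suc n) = alt_harm n + (-1) ^ Suc n / real (Suc n)"
  by (simp add: alt_harm_def)

text \<open>Leibniz estimate by downward induction: the tail after \<open>t\<close>, normalised by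
  the sign of its first term, is the size of that term minus the normalised tail after
  \<open>t + 1\<close>, which lies between 0 and a smaller reciprocal.\<close>

lemma alt_harm_diff_bounds:
  assumes "t \<le> N"
  shows "0 \<le> (-1) ^ Suc t * (alt_harm N - alt_harm t) \<and>
         (-1) ^ Suc t * (alt_harm N - alt_harm t) \<le> 1 / real (Suc t)"
  using assms
proof (induction t rule: inc_induct)
  case base
  then show ?case by simp
next
  case (step t)
  have "(-1) ^ Suc t * (alt_harm N - alt_harm t) =
        1 / real (Suc t) - (-1) ^ Suc (Suc t) * (alt_harm N - alt_harm (Suc t))"
    by (cases "even t") (simp_all add: alt_harm_Suc)
  moreover have "1 / real (Suc (Suc t)) \<le> 1 / real (Suc t)"
    by (intro divide_left_mono) auto
  ultimately show ?case using step.IH by linarith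
qed

lemma abs_alt_harm_diff_le:
  assumes "t \<le> N"
  shows "\<bar>alt_harm t - alt_harm N\<bar> \<le> 1 / real (Suc t)"
proof -
  have "\<bar>(-1) ^ Suc t * (alt_harm N - alt_harm t)\<bar> \<le> 1 / real (Suc t)"
    using alt_harm_diff_bounds[OF assms] by linarith
  then show ?thesis by (simp add: abs_mult abs_minus_commute)
qed

text \<open>The reflection j -> k - j negates k - 2j. For even \<open>k\<close> the middle term is 1
  / 0 = 0, which agrees with its own negative.\<close>

lemma sum_inverse_reflect_eq_0:
  "(\<Sum>j = 1..<k. 1 / (real k - 2 * real j)) = 0"
proof -
  have "(\<Sum>j = 1..<k. 1 / (real k - 2 * real j)) = (\<Sum>j = 1..<k. - (1 / (real k - 2 * real j)))"
  proof (rule sum.reindex_bij_witness[where i = "\<lambda>j. k - j" and j = "\<lambda>j. k - j"], goal_cases)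
    case (5 j)
    then show ?case by (simp add: of_nat_diff minus_divide_right)
  qed auto
  then show ?thesis by (simp add: sum_negf)
qed

text \<open>The term \<open>k = 2j\<close> of the sum is \<open>0\<close>, since \<open>x / 0 = 0\<close>.\<close>

lemma sum_alternating_shifted:
  assumes "1 \<le> j" "j \<le> K"
  shows "(\<Sum>k = Suc j..K. (-1) ^ k / (real k - 2 * real j)) =
         (if 2 * j \<le> K then alt_harm (K - 2 * j) else alt_harm (2 * j - K - 1)) - alt_harm (j - 1)"
  using assms(2)
proof (induction K rule: dec_induct)
  case base
  have "2 * j - j - 1 = j - 1" by simp
  then show ?case using assms(1) by simp
next
  case (step K)
  have *: "(\<Sum>k = Suc j..Suc K. (-1) ^ k / (real k - 2 * real j)) =
        (\<Sum>k = Suc j..K. (-1) ^ k / (real k - 2 * real j)) + (-1) ^ Suc K / (real (Suc K) - 2 * real j)"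
    using step.hyps by simp
  \<comment> \<open>The new denominator Suc K - 2j is positive, zero or negative; accordingly
    \<open>alt_harm\<close> gains a term, stays as it is, or loses its last term. At the crossing
    both branches of the formula are \<open>alt_harm 0\<close>.\<close>
  consider "2 * j \<le> K" | "Suc K = 2 * j" | "K + 2 \<le> 2 * j" by linarith
  then show ?case
  proof cases
    case 1
    then obtain d where "K = 2 * j + d" using le_Suc_ex by blast
    then show ?thesis
      unfolding * step.IH by (simp add: alt_harm_Suc Suc_diff_le power_add)
  next
    case 2
    then have "real (Suc K) = real (2 * j)" by (simp only:)
    then have "real (Suc K) - 2 * real j = 0" by simp
    with 2 show ?thesis unfolding * step.IH by simp
  next
    case 3
    then obtain d where d: "2 * j = K + 2 + d" using le_Suc_ex by blast
    have "real (2 * j) = real (K + 2 + d)" by (simp only: d)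
    then have r: "real (Suc K) - 2 * real j = - real (Suc d)" by simp
    have "even (K + d)" using d by presburger
    then have s: "(-1) ^ Suc K = ((-1) ^ Suc d :: real)"
      by (cases "even K") auto
    have "2 * j - K - 1 = Suc d" "2 * j - Suc K - 1 = d" "\<not> 2 * j \<le> K" "\<not> 2 * j \<le> Suc K"
      using d by auto
    then show ?thesis unfolding * step.IH r s divide_minus_right by (simp add: alt_harm_Suc)
  qed
qed

lemma sum_alternating_interval:
  assumes "1 \<le> j" "j \<le> K"
  shows "(\<Sum>k = j..K. (-1) ^ k / real k) = alt_harm K - alt_harm (j - 1)"
  using assms(2)
proof (induction K rule: dec_induct)
  case base
  then show ?case using assms(1) by (cases j) (simp_all add: alt_harm_Suc)
next
  case (step K)
  then show ?case by (simp add: alt_harm_Suc)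
qed

section \<open>The geometric sum over a + b = n\<close>

text \<open>With u = 1/j and v = 2/k the terms are u^(n-b+1) v^(b+1), and u - v = uv (k - 2j) / 2,
  so the factor uv cancels when the geometric sum is evaluated. If k = 2j, then u = v and all n + 1
  terms agree, while the last summand vanishes.\<close>

lemma sum_power_products_eq:
  assumes "j \<ge> 1" "k \<ge> 1"
  shows "(\<Sum>b\<le>n. 2 ^ (b + 1) / (real j ^ (n - b + 1) * real k ^ (b + 1))) =
         (if k = 2 * j then (real n + 1) / real j ^ (n + 2) else 0) +
         2 * (1 / real j ^ (n + 1) - (2 / real k) ^ (n + 1)) * (1 / (real k - 2 * real j))"
proof -
  define u v where "u = 1 / real j" and "v = 2 / real k"
  have "(\<Sum>b\<le>n. 2 ^ (b + 1) / (real j ^ (n - b + 1) * real k ^ (b + 1))) =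
        (\<Sum>b\<le>n. u * v * (u ^ (n - b) * v ^ b))"
    by (intro sum.cong) (simp_all add: u_def v_def power_divide)
  also have "\<dots> = u * v * (\<Sum>b<Suc n. u ^ (n - b) * v ^ b)"
    by (simp only: sum_distrib_left lessThan_Suc_atMost)
  finally have S: "(\<Sum>b\<le>n. 2 ^ (b + 1) / (real j ^ (n - b + 1) * real k ^ (b + 1))) =
        u * v * (\<Sum>b<Suc n. u ^ (n - b) * v ^ b)" .
  show ?thesis
  proof (cases "k = 2 * j")
    case True
    then have "v = u" using assms by (simp add: u_def v_def)
    then have "(\<Sum>b<Suc n. u ^ (n - b) * v ^ b) = (\<Sum>b<Suc n. u ^ n)"
      by (intro sum.cong) (auto simp flip: power_add)
    with True \<open>v = u\<close> show ?thesis
      unfolding S by (simp add: u_def power_divide add.commute mult.assoc)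
  next
    case False
    have r: "real k - 2 * real j \<noteq> 0" 
    proof
      assume "real k - 2 * real j = 0"
      then have "real k = real (2 * j)" by simp
      with False show False by (simp only: of_nat_eq_iff)
    qed
    have uv: "u - v = (u * v) * ((real k - 2 * real j) / 2)"
      using assms by (simp add: u_def v_def field_simps)
    have "u ^ Suc n - v ^ Suc n = (u - v) * (\<Sum>b<Suc n. u ^ (n - b) * v ^ b)"
      using power_diff_sumr2[of v "Suc n" u] by (simp add: algebra_simps)
    then have *: "u ^ Suc n - v ^ Suc n =
        ((real k - 2 * real j) / 2) * (u * v * (\<Sum>b<Suc n. u ^ (n - b) * v ^ b))"
      unfolding uv by (simp only: mult_ac)
    have "u * v * (\<Sum>b<Suc n. u ^ (n - b) * v ^ b) =
        2 * (u ^ Suc n - v ^ Suc n) * (1 / (real k - 2 * real j))"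
      unfolding * using r by simp
    with False show ?thesis unfolding S by (simp add: u_def v_def power_divide)
  qed
qed

section \<open>Truncated series and their exact identity\<close>

text \<open>Cutting at the larger index respects the order in which \<open>zeta2_bar\<close> is
  summed, and the finite sums can be rearranged freely.\<close>

definition zeta2_bar_partial :: "nat \<Rightarrow> nat \<Rightarrow> nat \<Rightarrow> real" where
  "zeta2_bar_partial s\<^sub>1 s\<^sub>2 K = (\<Sum>k = 1..K. \<Sum>j = 1..<k. (-1) ^ k / (real j ^ s\<^sub>1 * real k ^ s\<^sub>2))"

lemma zeta2_bar_partial_LIMSEQ:
  assumes "s\<^sub>1 \<ge> 1" "s\<^sub>2 \<ge> 1"
  shows "zeta2_bar_partial s\<^sub>1 s\<^sub>2 \<longlonglongrightarrow> zeta2_bar s\<^sub>1 s\<^sub>2"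
proof -
  have "zeta2_bar_partial s\<^sub>1 s\<^sub>2 =
    (\<lambda>K. \<Sum>k<K. \<Sum>j = 1..<Suc k. (-1) ^ Suc k / (real j ^ s\<^sub>1 * real (Suc k) ^ s\<^sub>2))"
    unfolding zeta2_bar_partial_def
    by (rule ext, rule sum.reindex_bij_witness[where i = Suc and j = "\<lambda>k. k - 1"]) auto
  with summable_LIMSEQ[OF summable_zeta2_bar[OF assms]] show ?thesis
    by (simp only: zeta2_bar_def)
qed

lemma sum_atLeast1_LIMSEQ:
  fixes f :: "nat \<Rightarrow> real"
  assumes "summable (\<lambda>k. f (Suc k))"
  shows "(\<lambda>N. \<Sum>k = 1..N. f k) \<longlonglongrightarrow> (\<Sum>k. f (Suc k))"
proof -
  have "(\<Sum>k = 1..N. f k) = (\<Sum>k<N. f (Suc k))" for N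
    by (rule sum.reindex_bij_witness[where i = Suc and j = "\<lambda>k. k - 1"]) auto
  with summable_LIMSEQ[OF assms] show ?thesis by simp
qed

text \<open>The cost of moving the upper end of every alternating harmonic sum to the cut-off. An
  even cut-off K = 2M turns the condition 2j \<le> K into j \<le> M.\<close>

definition truncation_error :: "nat \<Rightarrow> nat \<Rightarrow> real" where
  "truncation_error n M = (\<Sum>j = 1..2 * M. 1 / real j ^ (n + 1) *
     ((if j \<le> M then alt_harm (2 * M - 2 * j) else alt_harm (2 * j - 2 * M - 1)) - alt_harm (2 * M)))"

lemma sum_triangle_swap:
  fixes g :: "nat \<Rightarrow> nat \<Rightarrow> real"
  shows "(\<Sum>k = 1..K. \<Sum>j = 1..<k. g j k) = (\<Sum>j = 1..K. \<Sum>k = Suc j..K. g j k)"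
proof -
  have "(\<Sum>k = 1..K. \<Sum>j = 1..<k. g j k) = (\<Sum>(k, j) \<in> (SIGMA k:{1..K}. {1..<k}). g j k)"
    by (rule sum.Sigma) auto
  also have "\<dots> = (\<Sum>(j, k) \<in> (SIGMA j:{1..K}. {Suc j..K}). g j k)"
    by (rule sum.reindex_bij_witness[where i = "\<lambda>(j, k). (k, j)" and j = "\<lambda>(k, j). (j, k)"]) auto
  also have "\<dots> = (\<Sum>j = 1..K. \<Sum>k = Suc j..K. g j k)"
    by (rule sum.Sigma[symmetric]) auto
  finally show ?thesis .
qed

lemma truncated_identity:
  "(\<Sum>b\<le>n. 2 ^ (b + 1) * zeta2_bar_partial (n - b + 1) (b + 1) (2 * M)) =
   (real n + 1) * (\<Sum>j = 1..M. 1 / real j ^ (n + 2)) + 2 * zeta2_bar_partial (n + 1) 1 (2 * M) +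
   2 * (\<Sum>k = 1..2 * M. (-1) ^ k / real k ^ (n + 2)) + 2 * truncation_error n M"
proof -
  let ?K = "2 * M"
  define f where "f j = 1 / real j ^ (n + 1)" for j
  define d where "d j k = 1 / (real k - 2 * real j)" for j k :: nat
  define g where "g j k = (if k = 2 * j then (real n + 1) / real j ^ (n + 2) else 0)" for j k :: nat
  have "(\<Sum>b\<le>n. 2 ^ (b + 1) * zeta2_bar_partial (n - b + 1) (b + 1) ?K) =
     (\<Sum>k = 1..?K. \<Sum>j = 1..<k. (-1) ^ k *
        (\<Sum>b\<le>n. 2 ^ (b + 1) / (real j ^ (n - b + 1) * real k ^ (b + 1))))"
    unfolding zeta2_bar_partial_def sum_distrib_left sum.swap[where A = "{..n}"]
    by (simp add: mult_ac)
  also have "\<dots> = (\<Sum>k = 1..?K. \<Sum>j = 1..<k. (-1) ^ k * g j k + 2 * (f j * ((-1) ^ k * d j k))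
                     - 2 * (-1) ^ k * (2 / real k) ^ (n + 1) * d j k)"
    by (intro sum.cong refl, subst sum_power_products_eq) (auto simp: f_def g_def d_def algebra_simps)
  also have "\<dots> = (\<Sum>k = 1..?K. \<Sum>j = 1..<k. (-1) ^ k * g j k) +
                  2 * (\<Sum>k = 1..?K. \<Sum>j = 1..<k. f j * ((-1) ^ k * d j k)) -
                  (\<Sum>k = 1..?K. 2 * (-1) ^ k * (2 / real k) ^ (n + 1) * (\<Sum>j = 1..<k. d j k))"
    by (simp only: sum.distrib sum_subtractf sum_distrib_left)
  \<comment> \<open>Antisymmetry under j -> k - j removes the part whose weight depends on
    \<open>k\<close> alone.\<close>
  also have "(\<Sum>k = 1..?K. 2 * (-1) ^ k * (2 / real k) ^ (n + 1) * (\<Sum>j = 1..<k. d j k)) = 0"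
    unfolding d_def sum_inverse_reflect_eq_0 by simp
  also have "(\<Sum>k = 1..?K. \<Sum>j = 1..<k. (-1) ^ k * g j k) =
             (\<Sum>j = 1..?K. \<Sum>k = Suc j..?K. (-1) ^ k * g j k)"
    by (rule sum_triangle_swap)
  also have "\<dots> = (\<Sum>j = 1..?K. if j \<le> M then (real n + 1) / real j ^ (n + 2) else 0)"
  proof (intro sum.cong refl)
    fix j assume "j \<in> {1..?K}"
    \<comment> \<open>On the diagonal k = 2j the sign (-1)^k is 1.\<close>
    have "(\<Sum>k = Suc j..?K. (-1) ^ k * g j k) =
          (\<Sum>k = Suc j..?K. if k = 2 * j then (real n + 1) / real j ^ (n + 2) else 0)"
      by (intro sum.cong) (auto simp: g_def)
    then show "(\<Sum>k = Suc j..?K. (-1) ^ k * g j k) =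
               (if j \<le> M then (real n + 1) / real j ^ (n + 2) else 0)"
      using \<open>j \<in> {1..?K}\<close> by auto
  qed
  also have "\<dots> = (\<Sum>j = 1..M. (real n + 1) / real j ^ (n + 2))"
    by (rule sum.mono_neutral_cong_right) auto
  also have "\<dots> = (real n + 1) * (\<Sum>j = 1..M. 1 / real j ^ (n + 2))"
    by (simp add: sum_distrib_left)
  also have "(\<Sum>k = 1..?K. \<Sum>j = 1..<k. f j * ((-1) ^ k * d j k)) =
             (\<Sum>j = 1..?K. f j * (\<Sum>k = Suc j..?K. (-1) ^ k * d j k))"
    unfolding sum_distrib_left by (rule sum_triangle_swap)
  \<comment> \<open>The lower ends \<open>alt_harm (j - 1)\<close> of both inner sums coincide, so
    only the upper ends differ.\<close>
  also have "\<dots> = (\<Sum>j = 1..?K. f j * (\<Sum>k = j..?K. (-1) ^ k / real k)) + truncation_error n M"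
    unfolding truncation_error_def sum.distrib[symmetric]
  proof (intro sum.cong refl)
    fix j assume j: "j \<in> {1..?K}"
    then have "(\<Sum>k = Suc j..?K. (-1) ^ k * d j k) =
      (if j \<le> M then alt_harm (?K - 2 * j) else alt_harm (2 * j - ?K - 1)) - alt_harm (j - 1)"
      using sum_alternating_shifted[of j ?K] by (simp add: d_def)
    moreover have "(\<Sum>k = j..?K. (-1) ^ k / real k) = alt_harm ?K - alt_harm (j - 1)"
      using j by (intro sum_alternating_interval) auto
    ultimately show "f j * (\<Sum>k = Suc j..?K. (-1) ^ k * d j k) =
      f j * (\<Sum>k = j..?K. (-1) ^ k / real k) + 1 / real j ^ (n + 1) *
      ((if j \<le> M then alt_harm (?K - 2 * j) else alt_harm (2 * j - ?K - 1)) - alt_harm ?K)"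
      by (simp add: f_def diff_divide_distrib)
  qed
  \<comment> \<open>The term k = j yields the single barred sum, the terms k > j the double
    one.\<close>
  also have "(\<Sum>j = 1..?K. f j * (\<Sum>k = j..?K. (-1) ^ k / real k)) =
             (\<Sum>j = 1..?K. (-1) ^ j / real j ^ (n + 2) + (\<Sum>k = Suc j..?K. f j * ((-1) ^ k / real k)))"
    by (intro sum.cong refl, subst sum.atLeast_Suc_atMost)
       (auto simp: f_def distrib_left sum_distrib_left)
  also have "\<dots> = (\<Sum>k = 1..?K. (-1) ^ k / real k ^ (n + 2)) + zeta2_bar_partial (n + 1) 1 ?K"
    unfolding zeta2_bar_partial_def sum_triangle_swap sum.distrib f_def by simp
  finally show ?thesis by (simp add: algebra_simps)
qed

section \<open>Decay of the truncation error\<close>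

lemma truncation_error_LIMSEQ: "truncation_error n \<longlonglongrightarrow> 0"
proof (rule tendsto_rabs_zero_cancel, rule tendsto_sandwich[OF _ _ tendsto_const])
  \<comment> \<open>A common bound 1 / (|j - M| + 1) for the Leibniz estimates on both sides of
    \<open>M\<close>; its sum over \<open>j\<close> is at most two harmonic numbers.\<close>
  define w where "w M j = (if j \<le> M then 1 / real (M - j + 1) else 1 / real (j - M + 1))" for M j :: nat
  have harm_le: "harm (2 * M) \<le> 1 + ln (real (2 * M))" if "M \<ge> 1" for M
    using euler_mascheroni_sequence_decreasing[of 1 "2 * M"] that by (simp add: harm_def)
  have sum_w: "(\<Sum>j = 1..2 * M. w M j) \<le> 2 * harm (2 * M)" for M
  proof -
    have "(\<Sum>j = 1..2 * M. w M j) = (\<Sum>j = 1..M. w M j) + (\<Sum>j = M + 1..2 * M. w M j)"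
      using sum.ub_add_nat[of 1 M "w M" M] by (simp add: mult_2)
    also have "(\<Sum>j = 1..M. w M j) = (\<Sum>i = 1..M. 1 / real i)"
      by (rule sum.reindex_bij_witness[where i = "\<lambda>i. M + 1 - i" and j = "\<lambda>j. M + 1 - j"])
         (auto simp: w_def)
    also have "(\<Sum>j = M + 1..2 * M. w M j) = (\<Sum>i = 1..M. 1 / real (i + 1))"
      by (rule sum.reindex_bij_witness[where i = "\<lambda>i. M + i" and j = "\<lambda>j. j - M"])
         (auto simp: w_def)
    also have "\<dots> \<le> (\<Sum>i = 1..M. 1 / real i)"
      by (intro sum_mono divide_left_mono) auto
    also have "(\<Sum>i = 1..M. 1 / real i) \<le> harm (2 * M)"
      unfolding harm_def inverse_eq_divide by (intro sum_mono2) auto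
    finally show ?thesis by simp
  qed
  have bound: "\<bar>truncation_error n M\<bar> \<le> 3 * harm (2 * M) / real (M + 1)" for M
  proof -
    have "\<bar>truncation_error n M\<bar> \<le> (\<Sum>j = 1..2 * M. (1 / real j + w M j) / real (M + 1))"
      unfolding truncation_error_def
    proof (rule order.trans[OF sum_abs], rule sum_mono)
      fix j assume j: "j \<in> {1..2 * M}"
      let ?E = "if j \<le> M then alt_harm (2 * M - 2 * j) else alt_harm (2 * j - 2 * M - 1)"
      have E: "\<bar>?E - alt_harm (2 * M)\<bar> \<le> w M j"
      proof (cases "j \<le> M")
        case True
        have "\<bar>alt_harm (2 * M - 2 * j) - alt_harm (2 * M)\<bar> \<le> 1 / real (Suc (2 * M - 2 * j))"
          by (rule abs_alt_harm_diff_le) simp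
        also have "\<dots> \<le> 1 / real (M - j + 1)" using True by (intro divide_left_mono) auto
        finally show ?thesis using True by (simp add: w_def)
      next
        case False
        have "\<bar>alt_harm (2 * j - 2 * M - 1) - alt_harm (2 * M)\<bar> \<le> 1 / real (Suc (2 * j - 2 * M - 1))"
          using j by (intro abs_alt_harm_diff_le) auto
        also have "\<dots> \<le> 1 / real (j - M + 1)" using False by (intro divide_left_mono) auto
        finally show ?thesis using False by (simp add: w_def)
      qed
      have p: "1 / real j ^ (n + 1) \<le> 1 / real j"
        using j by (intro divide_left_mono self_le_power) auto
      have "\<bar>1 / real j ^ (n + 1) * (?E - alt_harm (2 * M))\<bar> \<le> 1 / real j * w M j"
        unfolding abs_mult using p E by (intro mult_mono) auto
      \<comment> \<open>Partial fractions: 1/(jy) = (1/j + 1/y) / (j + y) with j + y \<ge> M + 1.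
        This gains the factor 1/(M + 1) and leaves sums of logarithmic size.\<close>
      also have "\<dots> \<le> (1 / real j + w M j) / real (M + 1)"
      proof -
        define y where "y = (if j \<le> M then real (M - j + 1) else real (j - M + 1))"
        have w: "w M j = 1 / y" and y: "y > 0" "real (M + 1) \<le> real j + y"
          by (auto simp: w_def y_def)
        have "real j > 0" using j by simp
        with y show ?thesis unfolding w by (simp add: divide_simps)
      qed
      finally show "\<bar>1 / real j ^ (n + 1) * (?E - alt_harm (2 * M))\<bar> \<le>
                    (1 / real j + w M j) / real (M + 1)" .
    qed
    also have "\<dots> = (harm (2 * M) + (\<Sum>j = 1..2 * M. w M j)) / real (M + 1)"
      by (simp only: sum_divide_distrib[symmetric] sum.distrib harm_def inverse_eq_divide)
    also have "\<dots> \<le> 3 * harm (2 * M) / real (M + 1)"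
      using sum_w[of M] by (intro divide_right_mono) auto
    finally show ?thesis .
  qed
  show "\<forall>\<^sub>F M in sequentially. \<bar>truncation_error n M\<bar> \<le> 3 * (1 + ln (real (2 * M))) / real (M + 1)"
    using eventually_ge_at_top[of 1]
  proof eventually_elim
    case (elim M)
    have "3 * harm (2 * M) / real (M + 1) \<le> 3 * (1 + ln (real (2 * M))) / real (M + 1)"
      using harm_le[OF elim] by (intro divide_right_mono) auto
    with bound[of M] show ?case by linarith
  qed
  show "(\<lambda>M. 3 * (1 + ln (real (2 * M))) / real (M + 1)) \<longlonglongrightarrow> 0" by real_asymp
qed auto

section \<open>Passage to the limit\<close>

theorem theorem5p3:
  fixes n :: nat
  shows "(\<Sum>(a, b) \<in> {(a, b). a + b = n}. 2 ^ (b + 1) * zeta2_bar (a + 1) (b + 1)) =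
         (real n + 1) * zeta (n + 2) + 2 * zeta2_bar (n + 1) 1 + 2 * zeta_bar (n + 2)"
proof -
  \<comment> \<open>The finite identity is available at even cut-offs only; since each series
    converges, this subsequence has the same limit.\<close>
  have even_subseq: "(\<lambda>M. X (2 * M)) \<longlonglongrightarrow> L" if "X \<longlonglongrightarrow> L" for X :: "nat \<Rightarrow> real" and L
    using LIMSEQ_subseq_LIMSEQ[OF that, of "(*) 2"] by (simp add: strict_mono_def comp_def)
  have "(\<lambda>M. (real n + 1) * (\<Sum>j = 1..M. 1 / real j ^ (n + 2)) +
          2 * zeta2_bar_partial (n + 1) 1 (2 * M) +
          2 * (\<Sum>k = 1..2 * M. (-1) ^ k / real k ^ (n + 2)) + 2 * truncation_error n M)
        \<longlonglongrightarrow> (real n + 1) * zeta (n + 2) + 2 * zeta2_bar (n + 1) 1 + 2 * zeta_bar (n + 2) + 2 * 0"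
    unfolding zeta_def zeta_bar_def
    by (intro tendsto_intros truncation_error_LIMSEQ sum_atLeast1_LIMSEQ summable_zeta
          even_subseq[OF zeta2_bar_partial_LIMSEQ]
          even_subseq[OF sum_atLeast1_LIMSEQ] summable_zeta_bar) auto
  moreover have "(\<lambda>M. \<Sum>b\<le>n. 2 ^ (b + 1) * zeta2_bar_partial (n - b + 1) (b + 1) (2 * M))
        \<longlonglongrightarrow> (\<Sum>b\<le>n. 2 ^ (b + 1) * zeta2_bar (n - b + 1) (b + 1))"
    by (intro tendsto_intros even_subseq zeta2_bar_partial_LIMSEQ) auto
  ultimately have "(\<Sum>b\<le>n. 2 ^ (b + 1) * zeta2_bar (n - b + 1) (b + 1)) =
        (real n + 1) * zeta (n + 2) + 2 * zeta2_bar (n + 1) 1 + 2 * zeta_bar (n + 2)"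
    unfolding truncated_identity by (simp add: LIMSEQ_unique)
  moreover have "(\<Sum>(a, b) \<in> {(a, b). a + b = n}. 2 ^ (b + 1) * zeta2_bar (a + 1) (b + 1)) =
        (\<Sum>b\<le>n. 2 ^ (b + 1) * zeta2_bar (n - b + 1) (b + 1))"
    by (rule sum.reindex_bij_witness[where i = "\<lambda>b. (n - b, b)" and j = snd]) auto
  ultimately show ?thesis by simp
qed

end
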